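(* Let $G=(V,E)$ be a connected graph, $v\in V$, and let $a^{\mathsf T}x\le b$ be facet-defining for $\textsc{Bond}(G)$. Obtain $\bar G=(\bar V,\bar E)$ from $G$ by replacing $v$ by two adjacent new vertices $v_1,v_2$ and distributing the edges incident to $v$ arbitrarily among $v_1$ and $v_2$. Define $\varphi:\bar E\setminus\{v_1v_2\}\to E$ by $\varphi(e)=e$ if $v_1,v_2\notin e$, and $\varphi(e)=vw$ if $e=v_iw$ ($i=1,2$). Let $\omega$ be the weight of a maximum bond in $\bar G-v_1v_2$ separating $v_1$ and $v_2$, with respect to the edge weights $a_{\varphi(e)}$. Define $\bar a\in\mathbb{R}^{\bar E}$ by $\bar a_e=a_{\varphi(e)}$ for $e\neq v_1v_2$ and $\bar a_{v_1v_2}=b-\omega$. Then $\bar a^{\mathsf T}x\le b$ defines a facet of $\textsc{Bond}(\bar G)$.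
   Context: For a graph $G=(V,E)$ and $S\subseteq V$, the cut $\delta(S)=\{e\in E:|e\cap S|=1\}$ is a bond if $G[S]$ and $G[V\setminus S]$ are connected; it separates $u,w$ if exactly one of them lies in $S$. The weight of a bond $\delta$ w.r.t. weights $c$ is $\sum_{e\in\delta}c_e$. $x^\delta$ is the incidence vector, $\textsc{Bond}(G)=\mathrm{conv}\{x^\delta:\delta\text{ a bond}\}$. *)

theory Defs
  imports "HOL-Analysis.Analysis"
begin

definition simple_graph :: "'v set \<Rightarrow> 'v set set \<Rightarrow> bool" where
  "simple_graph V E \<longleftrightarrow> finite V \<and> (\<forall>e\<in>E. e \<subseteq> V \<and> card e = 2)"

text \<open>The graph without vertices counts as connected. Hence, in a connected graph, the empty
  cut is a bond (take \<open>S = {}\<close>).\<close>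
definition connected_graph :: "'v set \<Rightarrow> 'v set set \<Rightarrow> bool" where
  "connected_graph V E \<longleftrightarrow> (\<forall>u\<in>V. \<forall>w\<in>V. (u, w) \<in> {(x, y). {x, y} \<in> E}\<^sup>*)"

definition induced_edges :: "'v set set \<Rightarrow> 'v set \<Rightarrow> 'v set set" where
  "induced_edges E S = {e \<in> E. e \<subseteq> S}"

definition cut :: "'v set set \<Rightarrow> 'v set \<Rightarrow> 'v set set" where
  "cut E S = {e \<in> E. card (e \<inter> S) = 1}"

definition bond_side :: "'v set \<Rightarrow> 'v set set \<Rightarrow> 'v set \<Rightarrow> bool" where
  "bond_side V E S \<longleftrightarrow> S \<subseteq> V \<and> connected_graph S (induced_edges E S)
     \<and> connected_graph (V - S) (induced_edges E (V - S))"

definition bonds :: "'v set \<Rightarrow> 'v set set \<Rightarrow> 'v set set set" where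
  "bonds V E = {cut E S | S. bond_side V E S}"

definition separating_bonds :: "'v set \<Rightarrow> 'v set set \<Rightarrow> 'v \<Rightarrow> 'v \<Rightarrow> 'v set set set" where
  "separating_bonds V E u w = {cut E S | S. bond_side V E S \<and> (u \<in> S \<longleftrightarrow> w \<notin> S)}"

definition weight :: "('v set \<Rightarrow> real) \<Rightarrow> 'v set set \<Rightarrow> real" where
  "weight c D = (\<Sum>e\<in>D. c e)"

text \<open>The space \<open>\<real>\<^sup>E\<close> is represented as the coordinate subspace of \<open>real ^ 'v set\<close> of all
  vectors that vanish outside \<open>E\<close>. Faces and affine dimension do not depend on the ambient space.\<close>
definition incidence_vector :: "'v set set \<Rightarrow> real ^ ('v::finite) set" where
  "incidence_vector D = (\<chi> e. if e \<in> D then 1 else 0)"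

definition bond_polytope :: "('v::finite) set \<Rightarrow> 'v set set \<Rightarrow> (real ^ 'v set) set" where
  "bond_polytope V E = convex hull (incidence_vector ` bonds V E)"

text \<open>The inequality \<open>a\<^sup>T x \<le> b\<close> with \<open>a \<in> \<real>\<^sup>E\<close>; values of \<open>a\<close> outside \<open>E\<close> are irrelevant.\<close>
definition facet_defining ::
  "'v set set \<Rightarrow> (real ^ ('v::finite) set) set \<Rightarrow> ('v set \<Rightarrow> real) \<Rightarrow> real \<Rightarrow> bool" where
  "facet_defining E P a b \<longleftrightarrow>
     (\<forall>x\<in>P. (\<Sum>e\<in>E. a e * x $ e) \<le> b)
     \<and> {x \<in> P. (\<Sum>e\<in>E. a e * x $ e) = b} facet_of P"

definition split_vertices :: "'v set \<Rightarrow> 'v \<Rightarrow> 'v \<Rightarrow> 'v \<Rightarrow> 'v set" where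
  "split_vertices V v v1 v2 = (V - {v}) \<union> {v1, v2}"

text \<open>Of the edges incident to \<open>v\<close>, those in \<open>A\<close> are attached to \<open>v1\<close>, the others to \<open>v2\<close>.\<close>
definition split_edges :: "'v set set \<Rightarrow> 'v set set \<Rightarrow> 'v \<Rightarrow> 'v \<Rightarrow> 'v \<Rightarrow> 'v set set" where
  "split_edges E A v v1 v2 =
     {e \<in> E. v \<notin> e}
     \<union> {{v1, w} | w. {v, w} \<in> E \<and> {v, w} \<in> A}
     \<union> {{v2, w} | w. {v, w} \<in> E \<and> {v, w} \<notin> A}
     \<union> {{v1, v2}}"

definition split_map :: "'v \<Rightarrow> 'v \<Rightarrow> 'v \<Rightarrow> 'v set \<Rightarrow> 'v set" where
  "split_map v v1 v2 e = (if v1 \<notin> e \<and> v2 \<notin> e then e else insert v (e - {v1, v2}))"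

end

theory Submission
  imports Defs
begin

text \<open>The bonds of the split graph that do not separate \<open>v1\<close> and \<open>v2\<close> are exactly the bonds of the
  original graph, which embeds the original polytope (and its facet) into the hyperplane
  \<open>x $ {v1, v2} = 0\<close>. A maximum bond separating \<open>v1\<close> and \<open>v2\<close> satisfies the new inequality with equality
  by the choice of the coefficient \<open>b - \<omega>\<close>, and it lies off that hyperplane, so the dimension
  of the face goes up by at least one. This suffices because bond polytopes of connected graphs are
  full-dimensional: every cut of a connected vertex set is a disjoint union of bonds,
  and the unit vector of an edge \<open>uw\<close> is half of \<open>\<delta>(u) + \<delta>(w) - \<delta>({u, w})\<close>.\<close>

section \<open>Connectivity by bipartitions\<close>

definition adjacent_sets :: "'v set set \<Rightarrow> 'v set \<Rightarrow> 'v set \<Rightarrow> bool" where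
  "adjacent_sets E X Y \<longleftrightarrow> (\<exists>x\<in>X. \<exists>y\<in>Y. {x, y} \<in> E)"

text \<open>Connectedness of the subgraph induced on \<open>S\<close>, phrased by bipartitions
  instead of walks so that unions and lifts can be handled by set algebra. The empty set qualifies,
  as it does for \<open>connected_graph\<close>.\<close>

definition unsplittable :: "'v set set \<Rightarrow> 'v set \<Rightarrow> bool" where
  "unsplittable E S \<longleftrightarrow>
     (\<forall>X Y. X \<union> Y = S \<and> X \<inter> Y = {} \<and> X \<noteq> {} \<and> Y \<noteq> {} \<longrightarrow> adjacent_sets E X Y)"

lemma adjacent_sets_commute: "adjacent_sets E X Y \<longleftrightarrow> adjacent_sets E Y X"
  unfolding adjacent_sets_def by (metis insert_commute)

lemma adjacent_sets_mono:
  "adjacent_sets E X Y \<Longrightarrow> X \<subseteq> X' \<Longrightarrow> Y \<subseteq> Y' \<Longrightarrow> adjacent_sets E X' Y'"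
  unfolding adjacent_sets_def by blast

lemma unsplittableD:
  "unsplittable E S \<Longrightarrow> X \<union> Y = S \<Longrightarrow> X \<inter> Y = {} \<Longrightarrow> X \<noteq> {} \<Longrightarrow> Y \<noteq> {} \<Longrightarrow> adjacent_sets E X Y"
  unfolding unsplittable_def by blast

text \<open>Otherwise the traces of \<open>X\<close> and \<open>Y\<close> on \<open>S\<close> form a
  bipartition of \<open>S\<close>, and an edge between the traces also joins \<open>X\<close> and
  \<open>Y\<close>.\<close>

lemma unsplittable_cases:
  assumes "unsplittable E S" "\<not> adjacent_sets E X Y" "S \<subseteq> X \<union> Y" "X \<inter> Y = {}"
  shows "S \<inter> X = {} \<or> S \<inter> Y = {}"
proof (rule ccontr)
  assume "\<not> ?thesis"
  then have "adjacent_sets E (S \<inter> X) (S \<inter> Y)"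
    using assms by (intro unsplittableD[of E S]) auto
  then have "adjacent_sets E X Y" by (rule adjacent_sets_mono) auto
  then show False using assms(2) by contradiction
qed

lemma unsplittable_singleton: "unsplittable E {x}"
  unfolding unsplittable_def by (metis singleton_Un_iff Int_absorb)

text \<open>A walk cannot leave a block that has no edge to the other block; conversely, the
  vertices reachable from \<open>x\<close> form a block with no edge to the remainder of
  \<open>S\<close>.\<close>

lemma connected_graph_iff_unsplittable:
  "connected_graph S (induced_edges E S) \<longleftrightarrow> unsplittable E S"
proof
  assume c: "connected_graph S (induced_edges E S)"
  show "unsplittable E S"
    unfolding unsplittable_def
  proof (intro allI impI)
    fix X Y assume XY: "X \<union> Y = S \<and> X \<inter> Y = {} \<and> X \<noteq> {} \<and> Y \<noteq> {}"
    then obtain x y where xy: "x \<in> X" "y \<in> Y" by blast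
    show "adjacent_sets E X Y"
    proof (rule ccontr)
      assume n: "\<not> adjacent_sets E X Y"
      have "(x, y) \<in> {(x, y). {x, y} \<in> induced_edges E S}\<^sup>*"
        using c xy XY unfolding connected_graph_def by blast
      then have "y \<in> X"
      proof induction
        case base show ?case by (fact xy)
      next
        case (step y z)
        then show ?case
          using n XY unfolding adjacent_sets_def induced_edges_def by auto
      qed
      with xy XY show False by blast
    qed
  qed
next
  assume u: "unsplittable E S"
  let ?R = "{(x, y). {x, y} \<in> induced_edges E S}"
  have "(x, y) \<in> ?R\<^sup>*" if xy: "x \<in> S" "y \<in> S" for x y
  proof (rule ccontr)
    assume n: "(x, y) \<notin> ?R\<^sup>*"
    let ?X = "{z \<in> S. (x, z) \<in> ?R\<^sup>*}"
    have "adjacent_sets E ?X (S - ?X)"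
      using n xy by (intro unsplittableD[OF u]) auto
    then obtain p q where pq: "p \<in> ?X" "q \<in> S - ?X" "{p, q} \<in> E"
      unfolding adjacent_sets_def by blast
    then have "(p, q) \<in> ?R" unfolding induced_edges_def by auto
    with pq show False by (auto intro: rtrancl_into_rtrancl)
  qed
  then show "connected_graph S (induced_edges E S)" unfolding connected_graph_def by blast
qed

lemma bond_side_iff:
  "bond_side V E S \<longleftrightarrow> S \<subseteq> V \<and> unsplittable E S \<and> unsplittable E (V - S)"
  unfolding bond_side_def connected_graph_iff_unsplittable ..

text \<open>In a bipartition without crossing edges, each of \<open>S\<close> and \<open>T\<close>
  lies within one block. Both blocks being nonempty, they lie in different ones, contrary to the
  edge between them.\<close>

lemma unsplittable_Un:
  assumes "unsplittable E S" "unsplittable E T" "adjacent_sets E S T"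
  shows "unsplittable E (S \<union> T)"
  unfolding unsplittable_def
proof (intro allI impI, rule ccontr)
  fix X Y assume XY: "X \<union> Y = S \<union> T \<and> X \<inter> Y = {} \<and> X \<noteq> {} \<and> Y \<noteq> {}"
    and n: "\<not> adjacent_sets E X Y"
  have "S \<inter> X = {} \<or> S \<inter> Y = {}" "T \<inter> X = {} \<or> T \<inter> Y = {}"
    using unsplittable_cases[OF assms(1) n] unsplittable_cases[OF assms(2) n] XY by blast+
  then have "S \<subseteq> X \<and> T \<subseteq> Y \<or> S \<subseteq> Y \<and> T \<subseteq> X" using XY by blast
  then show False
    using n assms(3) adjacent_sets_mono[of E S T] adjacent_sets_commute[of E X Y] by blast
qed

text \<open>Grow a connected set from \<open>u\<close> that avoids \<open>w\<close> until it is
  maximal; then its complement is connected too. This later shows that the maximum defining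
  \<open>\<omega>\<close> ranges over a nonempty set.\<close>

lemma ex_separating_bond_side:
  fixes V :: "'v::finite set"
  assumes "unsplittable E V" "u \<in> V" "w \<in> V" "u \<noteq> w"
  obtains S where "bond_side V E S" "u \<in> S" "w \<notin> S"
proof -
  let ?C = "{S. S \<subseteq> V \<and> unsplittable E S \<and> u \<in> S \<and> w \<notin> S}"
  have "{u} \<in> ?C" using assms unsplittable_singleton by auto
  then have "\<exists>S\<in>?C. \<forall>T\<in>?C. S \<subseteq> T \<longrightarrow> S = T"
    by (intro finite_has_maximal finite) (metis empty_iff)
  then obtain S where S: "S \<in> ?C" and max: "\<forall>T\<in>?C. S \<subseteq> T \<longrightarrow> S = T"
    by (rule bexE)
  \<comment> \<open>By maximality, no vertex outside \<open>S\<close> other than \<open>w\<close> is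
    adjacent to \<open>S\<close>.\<close>
  have no: False if y: "y \<in> V - S" "y \<noteq> w" "adjacent_sets E S {y}" for y
  proof -
    have "unsplittable E (S \<union> {y})"
      using S y(3) by (intro unsplittable_Un unsplittable_singleton) simp_all
    then have "S \<union> {y} \<in> ?C" using S y(1,2) by simp
    then have "S = S \<union> {y}" using max[THEN bspec, of "S \<union> {y}"] by blast
    then show False using y(1) by blast
  qed
  \<comment> \<open>A block without \<open>w\<close> has an edge to the rest of \<open>V\<close>,
    and that edge cannot end in \<open>S\<close>.\<close>
  have aux: "adjacent_sets E X Y"
    if XY: "X \<union> Y = V - S" "X \<inter> Y = {}" "w \<in> X" "Y \<noteq> {}" for X Y
  proof -
    have "adjacent_sets E (S \<union> X) Y"
      using XY S by (intro unsplittableD[OF assms(1)]) auto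
    then obtain p y where py: "p \<in> S \<union> X" "y \<in> Y" "{p, y} \<in> E"
      unfolding adjacent_sets_def by blast
    have "p \<notin> S"
    proof
      assume "p \<in> S"
      then have "adjacent_sets E S {y}" using py(3) unfolding adjacent_sets_def by auto
      moreover have "y \<in> V - S" "y \<noteq> w" using py(2) XY by auto
      ultimately show False using no by simp
    qed
    with py have "p \<in> X" by simp
    with py(2,3) show ?thesis unfolding adjacent_sets_def by metis
  qed
  have "unsplittable E (V - S)"
    unfolding unsplittable_def
  proof (intro allI impI)
    fix X Y assume XY: "X \<union> Y = V - S \<and> X \<inter> Y = {} \<and> X \<noteq> {} \<and> Y \<noteq> {}"
    have "w \<in> X \<union> Y" using XY assms(3) S by simp
    then show "adjacent_sets E X Y"
    proof
      assume "w \<in> X"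
      with XY show ?thesis by (intro aux) simp_all
    next
      assume "w \<in> Y"
      with XY have "adjacent_sets E Y X" by (intro aux) (simp_all add: Un_commute Int_commute)
      then show ?thesis by (simp add: adjacent_sets_commute)
    qed
  qed
  then show ?thesis using S by (intro that[of S]) (simp_all add: bond_side_iff)
qed

section \<open>The bond polytope is full-dimensional\<close>

lemma doubleton_in_cut_iff:
  "x \<noteq> y \<Longrightarrow> {x, y} \<in> cut E S \<longleftrightarrow> {x, y} \<in> E \<and> (x \<in> S \<longleftrightarrow> y \<notin> S)"
  unfolding cut_def by (cases "x \<in> S"; cases "y \<in> S") auto

lemma simple_graph_edgeE:
  assumes "simple_graph V E" "e \<in> E"
  obtains x y where "e = {x, y}" "x \<noteq> y" "x \<in> V" "y \<in> V"
  using assms unfolding simple_graph_def card_2_iff by (metis insert_subset)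

lemma cut_subset: "cut E S \<subseteq> E"
  unfolding cut_def by blast

text \<open>A minimal nonempty part of \<open>U\<close> without edges to the rest of
  \<open>U\<close> is connected, since a bipartition without crossing edges would yield a smaller
  such part.\<close>

lemma ex_component:
  fixes U :: "'v::finite set"
  assumes "U \<noteq> {}"
  obtains T where "T \<noteq> {}" "T \<subseteq> U" "\<not> adjacent_sets E T (U - T)" "unsplittable E T"
proof -
  let ?C = "{T. T \<noteq> {} \<and> T \<subseteq> U \<and> \<not> adjacent_sets E T (U - T)}"
  have "U \<in> ?C" using assms unfolding adjacent_sets_def by auto
  then have "\<exists>T\<in>?C. \<forall>T'\<in>?C. T' \<subseteq> T \<longrightarrow> T = T'"
    by (intro finite_has_minimal finite) (metis empty_iff)
  then obtain T where T: "T \<in> ?C" and min: "\<forall>T'\<in>?C. T' \<subseteq> T \<longrightarrow> T = T'"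
    by (rule bexE)
  have "unsplittable E T"
    unfolding unsplittable_def
  proof (intro allI impI, rule ccontr)
    fix X Y assume XY: "X \<union> Y = T \<and> X \<inter> Y = {} \<and> X \<noteq> {} \<and> Y \<noteq> {}"
      and n: "\<not> adjacent_sets E X Y"
    have "X \<in> ?C"
      using T XY n unfolding adjacent_sets_def by blast
    then have "T = X" using min[THEN bspec, of X] XY by blast
    then show False using XY by blast
  qed
  then show ?thesis using that T by blast
qed

text \<open>If \<open>V - S\<close> is not connected, split off one of its components \<open>T\<close>: then \<open>T\<close> is a bond side,
  and \<open>cut E S\<close> is the disjoint union of \<open>cut E T\<close> and \<open>cut E (S \<union> T)\<close>.\<close>
lemma incidence_vector_cut_in_span_bonds:
  fixes V :: "'v::finite set"
  assumes G: "simple_graph V E" "unsplittable E V"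
  shows "S \<subseteq> V \<Longrightarrow> S \<noteq> {} \<Longrightarrow> unsplittable E S
    \<Longrightarrow> incidence_vector (cut E S) \<in> span (incidence_vector ` bonds V E)"
proof (induction "card (V - S)" arbitrary: S rule: less_induct)
  case less
  show ?case
  proof (cases "V - S = {}")
    case True
    then have "bond_side V E S"
      using less.prems unfolding bond_side_iff unsplittable_def by auto
    then show ?thesis unfolding bonds_def by (blast intro: span_base)
  next
    case False
    then obtain T where T: "T \<noteq> {}" "T \<subseteq> V - S" "\<not> adjacent_sets E T (V - S - T)"
      "unsplittable E T"
      using ex_component by metis
    \<comment> \<open>Some edge leaves \<open>T\<close> because \<open>V\<close> is connected, and
      it cannot end in \<open>V - S - T\<close>.\<close>
    have TS: "adjacent_sets E T S"
    proof -
      have "adjacent_sets E T (V - T)"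
        using T less.prems by (intro unsplittableD[OF G(2)]) auto
      then show ?thesis using T(3) unfolding adjacent_sets_def by blast
    qed
    \<comment> \<open>A block of \<open>V - T\<close> disjoint from \<open>S\<close> could be left
      only through \<open>T\<close>, but \<open>T\<close> has no edge to \<open>V - S - T\<close>.
      Since \<open>S\<close> is connected, any bipartition without crossing edges has such a
      block.\<close>
    have closed: False
      if "X \<union> Y = V - T" "X \<inter> Y = {}" "X \<noteq> {}" "\<not> adjacent_sets E X Y" "S \<inter> X = {}" for X Y
    proof -
      have "adjacent_sets E X (V - X)"
        using that T by (intro unsplittableD[OF G(2)]) auto
      then obtain x y where xy: "x \<in> X" "y \<in> V - X" "{x, y} \<in> E"
        unfolding adjacent_sets_def by blast
      have "y \<in> T" using xy that unfolding adjacent_sets_def by blast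
      moreover have "x \<in> V - S - T" using xy that by blast
      moreover have "{y, x} \<in> E" using xy by (simp add: insert_commute)
      ultimately show False using T(3) unfolding adjacent_sets_def by blast
    qed
    have "unsplittable E (V - T)"
      unfolding unsplittable_def
    proof (intro allI impI, rule ccontr)
      fix X Y assume XY: "X \<union> Y = V - T \<and> X \<inter> Y = {} \<and> X \<noteq> {} \<and> Y \<noteq> {}"
        and n: "\<not> adjacent_sets E X Y"
      have "S \<inter> X = {} \<or> S \<inter> Y = {}"
        using unsplittable_cases[OF less.prems(3) n] XY T less.prems by blast
      then show False
        using closed[of X Y] closed[of Y X] XY n adjacent_sets_commute[of E X Y] by blast
    qed
    then have "bond_side V E T" using T unfolding bond_side_iff by blast
    then have 1: "incidence_vector (cut E T) \<in> span (incidence_vector ` bonds V E)"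
      unfolding bonds_def by (blast intro: span_base)
    have "card (V - (S \<union> T)) < card (V - S)"
      using T by (intro psubset_card_mono) auto
    then have 2: "incidence_vector (cut E (S \<union> T)) \<in> span (incidence_vector ` bonds V E)"
      using less.prems T TS
      by (intro less.hyps) (auto intro!: unsplittable_Un simp: adjacent_sets_commute[of E S])
    \<comment> \<open>No edge joins \<open>T\<close> to the rest of \<open>V - S\<close>. Hence the
      first cut consists of the edges between \<open>S\<close> and \<open>T\<close>, the second of
      those between \<open>S\<close> and \<open>V - S - T\<close>.\<close>
    have "incidence_vector (cut E S) = incidence_vector (cut E T) + incidence_vector (cut E (S \<union> T))"
    proof (rule vec_eq_iff[THEN iffD2], rule allI)
      fix e
      show "incidence_vector (cut E S) $ e =
        (incidence_vector (cut E T) + incidence_vector (cut E (S \<union> T))) $ e"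
      proof (cases "e \<in> E")
        case True
        then obtain x y where e: "e = {x, y}" "x \<noteq> y" "x \<in> V" "y \<in> V"
          using simple_graph_edgeE[OF G(1)] by metis
        have "{y, x} \<in> E" "{x, y} \<in> E" using True e by (simp_all add: insert_commute)
        then have "x \<in> T \<Longrightarrow> y \<in> S \<or> y \<in> T" "y \<in> T \<Longrightarrow> x \<in> S \<or> x \<in> T"
          using T(3) e unfolding adjacent_sets_def by blast+
        moreover have "x \<in> T \<Longrightarrow> x \<notin> S" "y \<in> T \<Longrightarrow> y \<notin> S" using T by auto
        ultimately show ?thesis
          using \<open>{x, y} \<in> E\<close> e doubleton_in_cut_iff[OF e(2)]
          by (auto simp: incidence_vector_def)
      next
        case False
        then show ?thesis using cut_subset[of E] by (auto simp: incidence_vector_def)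
      qed
    qed
    then show ?thesis using 1 2 by (simp add: span_add)
  qed
qed

lemma axis_in_span_bonds:
  fixes V :: "'v::finite set"
  assumes G: "simple_graph V E" "unsplittable E V" and "e \<in> E"
  shows "axis e 1 \<in> span (incidence_vector ` bonds V E)"
proof -
  obtain u w where e: "e = {u, w}" "u \<noteq> w" "u \<in> V" "w \<in> V"
    using simple_graph_edgeE[OF G(1) assms(3)] .
  let ?c = "\<lambda>S. incidence_vector (cut E S) :: real ^ 'v set"
  have uw: "unsplittable E {u, w}"
    using unsplittable_Un[of E "{u}" "{w}"] unsplittable_singleton[of E] assms(3) e
    unfolding adjacent_sets_def by (simp add: insert_commute)
  \<comment> \<open>The edge \<open>e\<close> lies in both cuts around single vertices and not in
    the cut around the pair. Any other edge leaving the pair lies in exactly one of the former and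
    in the latter, so it cancels.\<close>
  have "axis e 1 = (1/2) *\<^sub>R (?c {u} + ?c {w} - ?c {u, w})"
  proof (rule vec_eq_iff[THEN iffD2], rule allI)
    fix f
    show "axis e 1 $ f = ((1/2) *\<^sub>R (?c {u} + ?c {w} - ?c {u, w})) $ f"
    proof (cases "f \<in> E")
      case True
      then obtain x y where f: "f = {x, y}" "x \<noteq> y" "x \<in> V" "y \<in> V"
        using simple_graph_edgeE[OF G(1)] by metis
      show ?thesis
        using True f e doubleton_in_cut_iff[OF f(2)]
        by (auto simp: incidence_vector_def axis_def doubleton_eq_iff)
    next
      case False
      then show ?thesis
        using cut_subset[of E] assms(3) by (auto simp: incidence_vector_def axis_def)
    qed
  qed
  moreover have "?c {u} \<in> span (incidence_vector ` bonds V E)"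
    "?c {w} \<in> span (incidence_vector ` bonds V E)"
    "?c {u, w} \<in> span (incidence_vector ` bonds V E)"
    using e uw unsplittable_singleton
    by (auto intro!: incidence_vector_cut_in_span_bonds[OF G])
  ultimately show ?thesis by (simp add: span_add span_diff span_scale)
qed

section \<open>Dimension bounds for the bond polytope\<close>

lemma card_le_aff_dim_bond_polytope:
  fixes V :: "'v::finite set"
  assumes G: "simple_graph V E" "unsplittable E V"
  shows "int (card E) \<le> aff_dim (bond_polytope V E)"
proof -
  let ?I = "incidence_vector ` bonds V E"
  \<comment> \<open>The sides \<open>{}\<close> and \<open>V\<close> give the empty bond, so the
    origin is among the generators and the affine dimension equals the linear one.\<close>
  have "bond_side V E {}" using G(2) unfolding bond_side_iff unsplittable_def by auto
  then have "cut E {} \<in> bonds V E" unfolding bonds_def by blast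
  moreover have "incidence_vector (cut E {}) = (0 :: real ^ 'v set)"
    by (simp add: incidence_vector_def cut_def vec_eq_iff)
  ultimately have "0 \<in> ?I" by (metis imageI)
  then have "aff_dim (bond_polytope V E) = int (dim ?I)"
    by (simp add: bond_polytope_def aff_dim_zero hull_inc aff_dim_convex_hull)
  moreover have "card ((\<lambda>e. axis e 1 :: real ^ 'v set) ` E) \<le> dim (span ?I)"
  proof (rule independent_card_le_dim)
    show "(\<lambda>e. axis e 1) ` E \<subseteq> span ?I" using axis_in_span_bonds[OF G] by blast
  next
    have "(\<lambda>e. axis e 1 :: real ^ 'v set) ` E \<subseteq> Basis" by (auto simp: Basis_vec_def)
    then show "independent ((\<lambda>e. axis e 1 :: real ^ 'v set) ` E)"
      using independent_Basis independent_mono by blast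
  qed
  moreover have "card ((\<lambda>e. axis e 1 :: real ^ 'v set) ` E) = card E"
    by (intro card_image inj_onI) (simp add: axis_eq_axis)
  ultimately show ?thesis by simp
qed

lemma bond_polytope_eq_0:
  "x \<in> bond_polytope V E \<Longrightarrow> e \<notin> E \<Longrightarrow> x $ e = 0"
proof -
  assume x: "x \<in> bond_polytope V E" and e: "e \<notin> E"
  have "bond_polytope V E \<subseteq> {x. x $ e = 0}"
    unfolding bond_polytope_def
  proof (rule hull_minimal)
    show "incidence_vector ` bonds V E \<subseteq> {x. x $ e = 0}"
      using e by (auto simp: bonds_def incidence_vector_def cut_def)
    show "convex {x :: real ^ 'a set. x $ e = 0}"
      by (simp add: convex_def)
  qed
  then show ?thesis using x by blast
qed

text \<open>Coordinates outside \<open>E\<close> vanish, which confines the polytope to the span of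
  the unit vectors of \<open>E\<close>. The lower bound serves for the original graph, this upper
  bound for the split graph.\<close>

lemma aff_dim_bond_polytope_le:
  "aff_dim (bond_polytope V E) \<le> int (card E)"
proof -
  let ?B = "(\<lambda>e. axis e 1 :: real ^ 'a set) ` E"
  have "x \<in> span ?B" if "x \<in> bond_polytope V E" for x
  proof -
    have "x = (\<Sum>e\<in>E. (x $ e) *\<^sub>R axis e 1)"
      using bond_polytope_eq_0[OF that]
      by (auto simp: vec_eq_iff axis_def if_distrib cong: if_cong)
    also have "\<dots> \<in> span ?B" by (intro span_sum span_scale span_base) auto
    finally show ?thesis .
  qed
  then have "aff_dim (bond_polytope V E) \<le> aff_dim (span ?B)"
    by (intro aff_dim_subset) auto
  also have "\<dots> = int (dim ?B)" by (simp add: aff_dim_subspace)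
  also have "\<dots> \<le> int (card E)"
    using dim_le_card'[of ?B] card_image_le[of E "\<lambda>e. axis e 1 :: real ^ 'a set"] by simp
  finally show ?thesis .
qed

section \<open>Splitting a vertex\<close>

lemma weight_eq_sum:
  fixes a :: "('v::finite) set \<Rightarrow> real"
  assumes "D \<subseteq> E"
  shows "(\<Sum>e\<in>E. a e * incidence_vector D $ e) = weight a D"
proof -
  have "(\<Sum>e\<in>E. a e * incidence_vector D $ e) = (\<Sum>e\<in>E. if e \<in> D then a e else 0)"
    by (intro sum.cong) (auto simp: incidence_vector_def)
  also have "\<dots> = weight a (E \<inter> D)"
    unfolding weight_def by (simp add: sum.inter_restrict)
  also have "E \<inter> D = D" using assms by blast
  finally show ?thesis .
qed

text \<open>As an inner product, with coefficients set to 0 outside \<open>E\<close>, the sum fits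
  the facts on half-spaces and supporting hyperplanes.\<close>

lemma sum_eq_inner:
  fixes x :: "real ^ 'i::finite"
  shows "(\<Sum>e\<in>E. a e * x $ e) = (\<chi> e. if e \<in> E then a e else 0) \<bullet> x"
proof -
  have "(\<Sum>e\<in>E. a e * x $ e) = (\<Sum>e\<in>UNIV. if e \<in> E then a e * x $ e else 0)"
    by (simp add: sum.inter_restrict[symmetric])
  also have "\<dots> = (\<chi> e. if e \<in> E then a e else 0) \<bullet> x"
    unfolding inner_vec_def by (intro sum.cong) auto
  finally show ?thesis .
qed

text \<open>Half-spaces are convex, so checking the generators of the hull suffices.\<close>

lemma bond_polytope_valid:
  assumes "\<And>S. bond_side V E S \<Longrightarrow> weight a (cut E S) \<le> b" and x: "x \<in> bond_polytope V E"
  shows "(\<Sum>e\<in>E. a e * x $ e) \<le> b"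
proof -
  have "bond_polytope V E \<subseteq> {x. (\<Sum>e\<in>E. a e * x $ e) \<le> b}"
    unfolding bond_polytope_def
  proof (rule hull_minimal)
    show "incidence_vector ` bonds V E \<subseteq> {x. (\<Sum>e\<in>E. a e * x $ e) \<le> b}"
      using assms(1) by (auto simp: bonds_def weight_eq_sum[OF cut_subset])
    show "convex {x. (\<Sum>e\<in>E. a e * x $ e) \<le> b}"
      unfolding sum_eq_inner by (rule convex_halfspace_le)
  qed
  then show ?thesis using x by blast
qed

lemma face_of_bond_polytope:
  assumes "\<forall>x\<in>bond_polytope V E. (\<Sum>e\<in>E. a e * x $ e) \<le> b"
  shows "{x \<in> bond_polytope V E. (\<Sum>e\<in>E. a e * x $ e) = b} face_of bond_polytope V E"
proof -
  have "convex (bond_polytope V E)" unfolding bond_polytope_def by (rule convex_convex_hull)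
  from face_of_Int_supporting_hyperplane_le[OF this] assms show ?thesis
    unfolding sum_eq_inner Int_def by auto
qed

section \<open>Contraction of the new edge and the correspondence of edges\<close>

locale vertex_split =
  fixes V :: "'v::finite set" and E A :: "'v set set" and v v1 v2 :: 'v
  assumes graph: "simple_graph V E"
    and v_in: "v \<in> V" and v1_notin: "v1 \<notin> V" and v2_notin: "v2 \<notin> V" and v1_neq_v2: "v1 \<noteq> v2"
begin

abbreviation "Vbar \<equiv> split_vertices V v v1 v2"
abbreviation "Ebar \<equiv> split_edges E A v v1 v2"
abbreviation "\<phi> \<equiv> split_map v v1 v2"

text \<open>\<open>proj\<close> contracts the new edge to \<open>v\<close>, and \<open>lift\<close>
  takes preimages. Since \<open>proj\<close> also fixes \<open>v\<close>, which is not a vertex of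
  the split graph, preimages are restricted to \<open>Vbar\<close>.\<close>

definition proj :: "'v \<Rightarrow> 'v" where
  "proj x = (if x = v1 \<or> x = v2 then v else x)"

definition lift :: "'v set \<Rightarrow> 'v set" where
  "lift S = {x \<in> Vbar. proj x \<in> S}"

lemma edgeD: "{x, y} \<in> E \<Longrightarrow> x \<in> V \<and> y \<in> V \<and> x \<noteq> y"
  using graph unfolding simple_graph_def by fastforce

lemma proj_in: "x \<in> Vbar \<Longrightarrow> proj x \<in> V"
  using v_in by (auto simp: proj_def split_vertices_def)

lemma ex_proj: "x \<in> V \<Longrightarrow> \<exists>x'\<in>Vbar. proj x' = x"
  using v1_notin v2_notin by (cases "x = v") (auto simp: proj_def split_vertices_def)

lemma proj_eqD:
  "proj x = proj y \<Longrightarrow> x \<in> Vbar \<Longrightarrow> y \<in> Vbar \<Longrightarrow> x = y \<or> {x, y} = {v1, v2}"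
  by (auto simp: proj_def split_vertices_def split: if_splits)

text \<open>One description of all edges other than the new one, so that later arguments need not
  distinguish how an edge was attached.\<close>

lemma split_edge_cases:
  assumes "e \<in> Ebar" "e \<noteq> {v1, v2}"
  obtains x y where "e = {x, y}" "x \<in> Vbar" "y \<in> Vbar" "x \<noteq> y" "{proj x, proj y} \<in> E"
    "\<phi> e = {proj x, proj y}"
proof -
  consider (old) "e \<in> E" "v \<notin> e" | (first) w where "e = {v1, w}" "{v, w} \<in> E"
    | (second) w where "e = {v2, w}" "{v, w} \<in> E"
    using assms unfolding split_edges_def by blast
  then show ?thesis
  proof cases
    case old
    then obtain x y where e: "e = {x, y}" "x \<noteq> y" "x \<in> V" "y \<in> V"
      using simple_graph_edgeE[OF graph] by metis
    then have "x \<noteq> v1" "x \<noteq> v2" "y \<noteq> v1" "y \<noteq> v2" using v1_notin v2_notin by auto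
    then show ?thesis
      using e old by (intro that[of x y]) (auto simp: proj_def split_vertices_def split_map_def)
  next
    case first
    then have w: "w \<in> V" "w \<noteq> v" "w \<noteq> v1" "w \<noteq> v2" using edgeD v1_notin v2_notin by blast+
    then show ?thesis using first
      by (intro that[of v1 w]) (auto simp: proj_def split_vertices_def split_map_def)
  next
    case second
    then have w: "w \<in> V" "w \<noteq> v" "w \<noteq> v1" "w \<noteq> v2" using edgeD v1_notin v2_notin by blast+
    then show ?thesis using second
      by (intro that[of v2 w]) (auto simp: proj_def split_vertices_def split_map_def)
  qed
qed

lemma new_edge_in: "{v1, v2} \<in> Ebar"
  unfolding split_edges_def by blast

lemma ex_lift_edge:
  assumes "{x, y} \<in> E"
  obtains x' y' where "x' \<in> Vbar" "y' \<in> Vbar" "proj x' = x" "proj y' = y" "{x', y'} \<in> Ebar"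
    "{x', y'} \<noteq> {v1, v2}"
proof -
  have xy: "x \<in> V" "y \<in> V" "x \<noteq> y" using edgeD[OF assms] by auto
  then have n: "x \<noteq> v1" "x \<noteq> v2" "y \<noteq> v1" "y \<noteq> v2" using v1_notin v2_notin by auto
  have at_v: "\<exists>z\<in>{v1, v2}. {z, w} \<in> Ebar" if "{v, w} \<in> E" for w
    using that unfolding split_edges_def by blast
  consider "x = v" | "y = v" | "x \<noteq> v" "y \<noteq> v" by blast
  then show ?thesis
  proof cases
    case 1
    then obtain z where "z \<in> {v1, v2}" "{z, y} \<in> Ebar" using at_v assms by blast
    then show ?thesis using 1 xy n
      by (intro that[of z y]) (auto simp: proj_def split_vertices_def doubleton_eq_iff)
  next
    case 2
    then obtain z where "z \<in> {v1, v2}" "{z, x} \<in> Ebar"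
      using at_v assms by (metis insert_commute)
    then show ?thesis using 2 xy n
      by (intro that[of x z])
        (auto simp: proj_def split_vertices_def doubleton_eq_iff insert_commute)
  next
    case 3
    then have "{x, y} \<in> Ebar" using assms unfolding split_edges_def by auto
    then show ?thesis using 3 xy n
      by (intro that[of x y]) (auto simp: proj_def split_vertices_def doubleton_eq_iff)
  qed
qed

text \<open>Each edge at \<open>v\<close> is attached to exactly one new vertex, so no two edges are
  identified. This transfers both sums over edges and their number.\<close>

lemma split_map_bij: "bij_betw \<phi> (Ebar - {{v1, v2}}) E"
  unfolding bij_betw_def
proof
  show "\<phi> ` (Ebar - {{v1, v2}}) = E"
  proof (intro equalityI subsetI)
    fix f assume "f \<in> \<phi> ` (Ebar - {{v1, v2}})"
    then show "f \<in> E" by (auto elim: split_edge_cases)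
  next
    fix f assume f: "f \<in> E"
    then obtain x y where "f = {x, y}" using simple_graph_edgeE[OF graph] by metis
    with f obtain x' y' where xy': "proj x' = x" "proj y' = y" "{x', y'} \<in> Ebar"
      "{x', y'} \<noteq> {v1, v2}"
      using ex_lift_edge by metis
    then obtain p q where "{x', y'} = {p, q}" "\<phi> {x', y'} = {proj p, proj q}"
      using split_edge_cases by metis
    then have "\<phi> {x', y'} = f" using xy' \<open>f = {x, y}\<close> by (auto simp: doubleton_eq_iff)
    then show "f \<in> \<phi> ` (Ebar - {{v1, v2}})" using xy' by blast
  qed
  show "inj_on \<phi> (Ebar - {{v1, v2}})"
  proof (rule inj_on_inverseI)
    fix e assume "e \<in> Ebar - {{v1, v2}}"
    then consider (old) "e \<in> E" "v \<notin> e" | (first) w where "e = {v1, w}" "{v, w} \<in> E" "{v, w} \<in> A"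
      | (second) w where "e = {v2, w}" "{v, w} \<in> E" "{v, w} \<notin> A"
      unfolding split_edges_def by blast
    \<comment> \<open>Left inverse of \<open>\<phi>\<close>: membership of the original edge in
      \<open>A\<close> determines which new vertex to put back.\<close>
    then show "(\<lambda>f. if v \<in> f then insert (if f \<in> A then v1 else v2) (f - {v}) else f) (\<phi> e) = e"
    proof cases
      case old
      then have "v1 \<notin> e" "v2 \<notin> e" using graph v1_notin v2_notin unfolding simple_graph_def by auto
      then show ?thesis using old by (simp add: split_map_def)
    next
      case first
      then have w: "w \<noteq> v" "w \<noteq> v1" "w \<noteq> v2" using edgeD v1_notin v2_notin by blast+
      then have "\<phi> e = {v, w}" using first by (auto simp: split_map_def)
      then show ?thesis using first w by auto
    next
      case second
      then have w: "w \<noteq> v" "w \<noteq> v1" "w \<noteq> v2" using edgeD v1_notin v2_notin by blast+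
      then have "\<phi> e = {v, w}" using second by (auto simp: split_map_def)
      then show ?thesis using second w by auto
    qed
  qed
qed

section \<open>Lifting connected sets, bond sides and cuts\<close>

lemma lift_subset: "lift S \<subseteq> Vbar"
  unfolding lift_def by blast

lemma lift_Diff: "lift (V - S) = Vbar - lift S"
  using proj_in unfolding lift_def by blast

text \<open>The only fibre of \<open>proj\<close> on \<open>Vbar\<close> with two elements is the
  pair of new vertices, so a set that does not separate them is a union of fibres.\<close>

lemma lift_proj_image:
  assumes "S \<subseteq> Vbar" "v1 \<in> S \<longleftrightarrow> v2 \<in> S"
  shows "lift (proj ` S) = S"
proof
  show "S \<subseteq> lift (proj ` S)" using assms(1) unfolding lift_def by auto
  show "lift (proj ` S) \<subseteq> S"
  proof
    fix x assume "x \<in> lift (proj ` S)"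
    then obtain y where "x \<in> Vbar" "y \<in> S" "proj x = proj y" unfolding lift_def by blast
    then show "x \<in> S" using proj_eqD[of x y] assms by (auto simp: doubleton_eq_iff)
  qed
qed

lemma proj_image_lift:
  assumes "S \<subseteq> V"
  shows "proj ` lift S = S"
proof
  show "S \<subseteq> proj ` lift S"
  proof
    fix x assume "x \<in> S"
    then obtain x' where "x' \<in> Vbar" "proj x' = x" using ex_proj assms by blast
    then show "x \<in> proj ` lift S" using \<open>x \<in> S\<close> unfolding lift_def by auto
  qed
qed (auto simp: lift_def)

text \<open>Contracting or expanding an edge preserves connectedness, because the only fibre with
  two vertices consists of adjacent ones. Applied to a side and its complement, this transfers
  bonds.\<close>

lemma unsplittable_lift_iff:
  assumes S: "S \<subseteq> V"
  shows "unsplittable Ebar (lift S) \<longleftrightarrow> unsplittable E S"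
proof
  assume u: "unsplittable Ebar (lift S)"
  show "unsplittable E S"
    unfolding unsplittable_def
  proof (intro allI impI)
    fix X Y assume XY: "X \<union> Y = S \<and> X \<inter> Y = {} \<and> X \<noteq> {} \<and> Y \<noteq> {}"
    have "proj ` lift X = X" "proj ` lift Y = Y"
      using XY S by (auto intro!: proj_image_lift)
    then have "lift X \<noteq> {}" "lift Y \<noteq> {}" using XY by auto
    moreover have "lift X \<union> lift Y = lift S" "lift X \<inter> lift Y = {}"
      using XY unfolding lift_def by auto
    ultimately have "adjacent_sets Ebar (lift X) (lift Y)" by (intro unsplittableD[OF u])
    then obtain x y where xy: "x \<in> lift X" "y \<in> lift Y" "{x, y} \<in> Ebar"
      unfolding adjacent_sets_def by blast
    then have pr: "proj x \<in> X" "proj y \<in> Y" unfolding lift_def by auto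
    \<comment> \<open>The new edge collapses to a single vertex, which cannot lie in both
      blocks.\<close>
    have "{x, y} \<noteq> {v1, v2}"
    proof
      assume "{x, y} = {v1, v2}"
      then have "proj x = proj y" by (auto simp: proj_def doubleton_eq_iff)
      then show False using pr XY by auto
    qed
    then obtain p q where "{x, y} = {p, q}" "{proj p, proj q} \<in> E"
      using split_edge_cases xy(3) by metis
    then have "{proj x, proj y} \<in> E" by (auto simp: doubleton_eq_iff insert_commute)
    then show "adjacent_sets E X Y" using pr unfolding adjacent_sets_def by blast
  qed
next
  assume u: "unsplittable E S"
  show "unsplittable Ebar (lift S)"
    unfolding unsplittable_def
  proof (intro allI impI)
    fix X Y assume XY: "X \<union> Y = lift S \<and> X \<inter> Y = {} \<and> X \<noteq> {} \<and> Y \<noteq> {}"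
    show "adjacent_sets Ebar X Y"
    \<comment> \<open>If no fibre is divided, the bipartition descends to \<open>S\<close>;
      otherwise the divided fibre is the new pair, and the new edge joins the blocks.\<close>
    proof (cases "proj ` X \<inter> proj ` Y = {}")
      case True
      have "proj ` X \<union> proj ` Y = proj ` lift S" using XY by (simp add: image_Un[symmetric])
      also have "\<dots> = S" by (rule proj_image_lift[OF S])
      finally have "adjacent_sets E (proj ` X) (proj ` Y)"
        using True XY by (intro unsplittableD[OF u]) auto
      then obtain x y where xy: "x \<in> proj ` X" "y \<in> proj ` Y" "{x, y} \<in> E"
        unfolding adjacent_sets_def by blast
      then obtain x' y' where xy': "x' \<in> Vbar" "y' \<in> Vbar" "proj x' = x" "proj y' = y"
        "{x', y'} \<in> Ebar"
        using ex_lift_edge by metis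
      have "proj ` X \<subseteq> S" "proj ` Y \<subseteq> S" using XY unfolding lift_def by auto
      then have "x' \<in> lift S" "y' \<in> lift S" using xy xy' unfolding lift_def by auto
      moreover have "x' \<notin> Y" "y' \<notin> X" using xy xy' True by auto
      ultimately have "x' \<in> X" "y' \<in> Y" using XY by auto
      then show ?thesis using xy' unfolding adjacent_sets_def by blast
    next
      case False
      then obtain x y where xy: "x \<in> X" "y \<in> Y" "proj x = proj y" by auto
      moreover have "x \<in> Vbar" "y \<in> Vbar" "x \<noteq> y" using xy XY lift_subset by blast+
      ultimately have "{x, y} = {v1, v2}" using proj_eqD by blast
      then have "{x, y} \<in> Ebar" using new_edge_in by simp
      then show ?thesis using xy(1,2) unfolding adjacent_sets_def by blast
    qed
  qed
qed

lemma bond_side_lift_iff: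
  "S \<subseteq> V \<Longrightarrow> bond_side Vbar Ebar (lift S) \<longleftrightarrow> bond_side V E S"
  by (simp add: bond_side_iff lift_subset lift_Diff[symmetric] unsplittable_lift_iff)

lemma cut_lift_iff:
  assumes e: "e \<in> Ebar" "e \<noteq> {v1, v2}"
  shows "e \<in> cut Ebar (lift S) \<longleftrightarrow> \<phi> e \<in> cut E S"
proof -
  obtain x y where xy: "e = {x, y}" "x \<in> Vbar" "y \<in> Vbar" "x \<noteq> y" "{proj x, proj y} \<in> E"
    "\<phi> e = {proj x, proj y}"
    using split_edge_cases[OF e] .
  have "proj x \<noteq> proj y" using edgeD[OF xy(5)] by blast
  then show ?thesis
    using e xy doubleton_in_cut_iff[of x y Ebar] doubleton_in_cut_iff[of "proj x" "proj y" E]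
    by (simp add: lift_def)
qed

lemma new_edge_in_cut_iff: "{v1, v2} \<in> cut Ebar S \<longleftrightarrow> (v1 \<in> S \<longleftrightarrow> v2 \<notin> S)"
  using doubleton_in_cut_iff[OF v1_neq_v2] new_edge_in by simp

lemma cut_Diff_new_edge: "cut (Ebar - {{v1, v2}}) S = cut Ebar S - {{v1, v2}}"
  unfolding cut_def by blast

text \<open>The new edge crosses the cut and so lies in neither induced subgraph. This links the
  bonds that define \<open>\<omega>\<close> to bonds of the split graph.\<close>

lemma bond_side_separating_iff:
  assumes "v1 \<in> S \<longleftrightarrow> v2 \<notin> S"
  shows "bond_side Vbar (Ebar - {{v1, v2}}) S \<longleftrightarrow> bond_side Vbar Ebar S"
proof -
  have "induced_edges (Ebar - {{v1, v2}}) S = induced_edges Ebar S"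
    "induced_edges (Ebar - {{v1, v2}}) (Vbar - S) = induced_edges Ebar (Vbar - S)"
    using assms unfolding induced_edges_def by auto
  then show ?thesis unfolding bond_side_def by simp
qed

section \<open>Linear embedding of the original polytope\<close>

text \<open>Linear counterpart of \<open>lift\<close> on incidence vectors; its image lies in the
  hyperplane where the new coordinate is 0.\<close>

definition embed :: "real ^ 'v set \<Rightarrow> real ^ 'v set" where
  "embed x = (\<chi> e. if e \<in> Ebar - {{v1, v2}} then x $ \<phi> e else 0)"

lemma linear_embed: "linear embed"
  by (rule linearI) (auto simp: embed_def vec_eq_iff)

lemma embed_incidence_vector:
  "embed (incidence_vector (cut E S)) = incidence_vector (cut Ebar (lift S))"
proof -
  have "{v1, v2} \<notin> cut Ebar (lift S)"
    unfolding new_edge_in_cut_iff by (simp add: lift_def split_vertices_def proj_def)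
  then show ?thesis
    using cut_lift_iff cut_subset[of Ebar]
    by (auto simp: embed_def incidence_vector_def vec_eq_iff)
qed

lemma embed_bond_polytope: "embed ` bond_polytope V E \<subseteq> bond_polytope Vbar Ebar"
proof -
  have "embed ` incidence_vector ` bonds V E \<subseteq> incidence_vector ` bonds Vbar Ebar"
  proof clarify
    fix D assume "D \<in> bonds V E"
    then obtain S where "D = cut E S" "bond_side V E S" unfolding bonds_def by blast
    moreover from this have "bond_side Vbar Ebar (lift S)"
      using bond_side_lift_iff bond_side_iff by metis
    ultimately show "embed (incidence_vector D) \<in> incidence_vector ` bonds Vbar Ebar"
      using embed_incidence_vector unfolding bonds_def by auto
  qed
  then show ?thesis
    unfolding bond_polytope_def convex_hull_linear_image[OF linear_embed] by (rule hull_mono)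
qed

lemma sum_embed:
  assumes "\<And>e. e \<noteq> {v1, v2} \<Longrightarrow> abar e = a (\<phi> e)"
  shows "(\<Sum>e\<in>Ebar. abar e * embed x $ e) = (\<Sum>e\<in>E. a e * x $ e)"
proof -
  have "(\<Sum>e\<in>Ebar. abar e * embed x $ e) = (\<Sum>e\<in>Ebar - {{v1, v2}}. abar e * embed x $ e)"
    by (rule sum.mono_neutral_right) (auto simp: embed_def)
  also have "\<dots> = (\<Sum>e\<in>Ebar - {{v1, v2}}. a (\<phi> e) * x $ \<phi> e)"
    using assms by (intro sum.cong) (auto simp: embed_def)
  also have "\<dots> = (\<Sum>e\<in>E. a e * x $ e)"
    by (rule sum.reindex_bij_betw[OF split_map_bij])
  finally show ?thesis .
qed

text \<open>On the polytope, \<open>embed\<close> has a linear left inverse, and linear images do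
  not raise the affine dimension.\<close>

lemma aff_dim_embed:
  assumes "F \<subseteq> bond_polytope V E"
  shows "aff_dim F \<le> aff_dim (embed ` F)"
proof -
  \<comment> \<open>Coordinates are read back along the inverse of \<open>\<phi>\<close>; the
    default 0 outside \<open>E\<close> agrees with the points of the polytope.\<close>
  define M :: "real ^ 'v set \<Rightarrow> real ^ 'v set"
    where "M x = (\<chi> f. if f \<in> E then x $ inv_into (Ebar - {{v1, v2}}) \<phi> f else 0)" for x
  have "linear M" by (rule linearI) (auto simp: M_def vec_eq_iff)
  have "M (embed x) = x" if "x \<in> F" for x
  proof (rule vec_eq_iff[THEN iffD2], rule allI)
    fix f
    show "M (embed x) $ f = x $ f"
    proof (cases "f \<in> E")
      case True
      then have "inv_into (Ebar - {{v1, v2}}) \<phi> f \<in> Ebar - {{v1, v2}}"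
        "\<phi> (inv_into (Ebar - {{v1, v2}}) \<phi> f) = f"
        using split_map_bij unfolding bij_betw_def by (metis inv_into_into, metis f_inv_into_f)
      then show ?thesis using True by (simp add: M_def embed_def)
    next
      case False
      then show ?thesis using bond_polytope_eq_0[of x V E f] assms that by (auto simp: M_def)
    qed
  qed
  then have "M ` embed ` F = F" by (force simp: image_image)
  then show ?thesis using aff_dim_linear_image_le[OF \<open>linear M\<close>, of "embed ` F"] by simp
qed

lemma card_split_edges: "card Ebar = Suc (card E)"
  using bij_betw_same_card[OF split_map_bij] card.remove[OF _ new_edge_in] by simp

section \<open>Validity and dimension of the new face\<close>

lemma facet_defining_split:
  assumes conn: "unsplittable E V" and facet: "facet_defining E (bond_polytope V E) a b"
    and \<omega>: "\<omega> = Max (weight (\<lambda>e. a (\<phi> e)) ` separating_bonds Vbar (Ebar - {{v1, v2}}) v1 v2)"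
    and abar: "abar = (\<lambda>e. if e = {v1, v2} then b - \<omega> else a (\<phi> e))"
  shows "facet_defining Ebar (bond_polytope Vbar Ebar) abar b"
proof -
  let ?P = "bond_polytope V E" and ?Pbar = "bond_polytope Vbar Ebar"
  let ?sep = "separating_bonds Vbar (Ebar - {{v1, v2}}) v1 v2"
  define F where "F = {x \<in> ?P. (\<Sum>e\<in>E. a e * x $ e) = b}"
  define Fbar where "Fbar = {x \<in> ?Pbar. (\<Sum>e\<in>Ebar. abar e * x $ e) = b}"
  have valid: "\<And>x. x \<in> ?P \<Longrightarrow> (\<Sum>e\<in>E. a e * x $ e) \<le> b" and F: "F facet_of ?P"
    using facet unfolding facet_defining_def F_def by auto
  have embed_sum: "(\<Sum>e\<in>Ebar. abar e * embed x $ e) = (\<Sum>e\<in>E. a e * x $ e)" for x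
    by (rule sum_embed) (simp add: abar)
  \<comment> \<open>A separating cut contains the new edge, which contributes
    \<open>b - \<omega>\<close>.\<close>
  have weight_sep: "weight abar (cut Ebar S) = b - \<omega> + weight (\<lambda>e. a (\<phi> e)) (cut (Ebar - {{v1, v2}}) S)"
    if "v1 \<in> S \<longleftrightarrow> v2 \<notin> S" for S
  proof -
    have "weight abar (cut Ebar S) = abar {v1, v2} + weight abar (cut Ebar S - {{v1, v2}})"
      unfolding weight_def using that new_edge_in_cut_iff by (intro sum.remove) simp_all
    also have "weight abar (cut Ebar S - {{v1, v2}})
        = weight (\<lambda>e. a (\<phi> e)) (cut (Ebar - {{v1, v2}}) S)"
      unfolding weight_def cut_Diff_new_edge abar by (intro sum.cong) auto
    finally show ?thesis by (simp add: abar)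
  qed
  \<comment> \<open>A bond that keeps the new vertices together is a lift and inherits the old
    inequality. For the others, \<open>\<omega>\<close> bounds the weight without the new
    edge.\<close>
  have "weight abar (cut Ebar S) \<le> b" if S: "bond_side Vbar Ebar S" for S
  proof (cases "v1 \<in> S \<longleftrightarrow> v2 \<in> S")
    case True
    let ?T = "proj ` S"
    have "S \<subseteq> Vbar" using S unfolding bond_side_def by blast
    then have T: "?T \<subseteq> V" "lift ?T = S" using proj_in lift_proj_image True by auto
    then have "bond_side V E ?T" using bond_side_lift_iff S by metis
    then have "incidence_vector (cut E ?T) \<in> ?P"
      unfolding bond_polytope_def bonds_def by (blast intro: hull_inc)
    from valid[OF this] show ?thesis
      using embed_sum[of "incidence_vector (cut E ?T)"] embed_incidence_vector[of ?T] T(2)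
      by (simp add: weight_eq_sum[OF cut_subset])
  next
    case False
    then have "cut (Ebar - {{v1, v2}}) S \<in> ?sep"
      using S bond_side_separating_iff[of S] unfolding separating_bonds_def by blast
    then have "weight (\<lambda>e. a (\<phi> e)) (cut (Ebar - {{v1, v2}}) S) \<le> \<omega>"
      unfolding \<omega> by (intro Max_ge) simp_all
    then show ?thesis using weight_sep[of S] False by auto
  qed
  then have valid_bar: "\<forall>x\<in>?Pbar. (\<Sum>e\<in>Ebar. abar e * x $ e) \<le> b"
    using bond_polytope_valid by blast
  then have face: "Fbar face_of ?Pbar"
    unfolding Fbar_def by (rule face_of_bond_polytope)
  have embed_F: "embed ` F \<subseteq> Fbar"
    using embed_bond_polytope embed_sum unfolding F_def Fbar_def by auto
  \<comment> \<open>The witness is a maximum separating bond together with the new edge.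
    Connectedness of the split graph yields some separating bond, so \<open>Max\<close> is
    attained.\<close>
  obtain p where p: "p \<in> Fbar" "p $ {v1, v2} = 1"
  proof -
    have "lift V = Vbar" using proj_in unfolding lift_def by blast
    then have "unsplittable Ebar Vbar" using unsplittable_lift_iff[of V] conn by simp
    then obtain R where R: "bond_side Vbar Ebar R" "v1 \<in> R" "v2 \<notin> R"
      using ex_separating_bond_side[of Ebar Vbar v1 v2] v1_neq_v2
      by (auto simp: split_vertices_def)
    then have "cut (Ebar - {{v1, v2}}) R \<in> ?sep"
      using bond_side_separating_iff[of R] unfolding separating_bonds_def by blast
    then have "\<omega> \<in> weight (\<lambda>e. a (\<phi> e)) ` ?sep"
      unfolding \<omega> by (intro Max_in) auto
    then obtain S where S: "bond_side Vbar (Ebar - {{v1, v2}}) S" "v1 \<in> S \<longleftrightarrow> v2 \<notin> S"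
      "\<omega> = weight (\<lambda>e. a (\<phi> e)) (cut (Ebar - {{v1, v2}}) S)"
      unfolding separating_bonds_def by auto
    then have "incidence_vector (cut Ebar S) \<in> ?Pbar"
      unfolding bond_polytope_def bonds_def bond_side_separating_iff[OF S(2)]
      by (blast intro: hull_inc)
    moreover have "weight abar (cut Ebar S) = b" using weight_sep S by simp
    moreover have "incidence_vector (cut Ebar S) $ {v1, v2} = (1 :: real)"
      using S(2) new_edge_in_cut_iff by (simp add: incidence_vector_def)
    ultimately show ?thesis
      using that[of "incidence_vector (cut Ebar S)"]
      unfolding Fbar_def by (simp add: weight_eq_sum[OF cut_subset])
  qed
  have "p \<notin> affine hull (embed ` F)"
  proof -
    have "affine hull (embed ` F) \<subseteq> {x. x $ {v1, v2} = 0}"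
      by (rule hull_minimal) (auto simp: embed_def affine_def)
    then show ?thesis using p(2) by auto
  qed
  then have "aff_dim (embed ` F) + 1 = aff_dim (insert p (embed ` F))"
    by (simp add: aff_dim_insert)
  also have "\<dots> \<le> aff_dim Fbar" using p embed_F by (intro aff_dim_subset) simp
  finally have "aff_dim F + 1 \<le> aff_dim Fbar"
    using aff_dim_embed[of F] unfolding F_def by fastforce
  moreover have "aff_dim F = aff_dim ?P - 1" using F unfolding facet_of_def by blast
  moreover have "int (card E) \<le> aff_dim ?P"
    by (rule card_le_aff_dim_bond_polytope[OF graph conn])
  moreover have "aff_dim Fbar < aff_dim ?Pbar"
  proof (rule face_of_aff_dim_lt[OF _ face])
    show "convex ?Pbar" unfolding bond_polytope_def by (rule convex_convex_hull)
    \<comment> \<open>A point of \<open>?P\<close> off the old facet stays off the new face after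
      embedding, so the new face is proper.\<close>
    have "F \<noteq> ?P" using F unfolding facet_of_def by auto
    then obtain x where "x \<in> ?P" "x \<notin> F" unfolding F_def by blast
    then have "embed x \<in> ?Pbar" "embed x \<notin> Fbar"
      using embed_bond_polytope embed_sum unfolding F_def Fbar_def by auto
    then show "Fbar \<noteq> ?Pbar" by blast
  qed
  moreover have "aff_dim ?Pbar \<le> int (card E) + 1"
    using aff_dim_bond_polytope_le[of Vbar Ebar] card_split_edges by simp
  \<comment> \<open>With \<open>m = card E\<close>, the old facet has dimension at least
    \<open>m - 1\<close>, hence the new face at least \<open>m\<close>. It is proper in a polytope
    of dimension at most \<open>m + 1\<close>, which forces codimension one.\<close>
  ultimately have "aff_dim Fbar = aff_dim ?Pbar - 1" by linarith
  then have "Fbar facet_of ?Pbar" using face p(1) unfolding facet_of_def by blast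
  then show ?thesis using valid_bar unfolding facet_defining_def Fbar_def by blast
qed

end

theorem theorem4p1:
  fixes V Vbar :: "('v::finite) set" and E Ebar A :: "'v set set"
    and v v1 v2 :: 'v
    and a abar :: "'v set \<Rightarrow> real" and b \<omega> :: real
    and \<phi> :: "'v set \<Rightarrow> 'v set"
  assumes "simple_graph V E" and "connected_graph V E" and "v \<in> V"
    and "facet_defining E (bond_polytope V E) a b"
    and "v1 \<notin> V" and "v2 \<notin> V" and "v1 \<noteq> v2"
    and "A \<subseteq> {e \<in> E. v \<in> e}"
    and "Vbar = split_vertices V v v1 v2"
    and "Ebar = split_edges E A v v1 v2"
    and "\<phi> = split_map v v1 v2"
    and "\<omega> = Max (weight (\<lambda>e. a (\<phi> e)) ` separating_bonds Vbar (Ebar - {{v1, v2}}) v1 v2)"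
    and "abar = (\<lambda>e. if e = {v1, v2} then b - \<omega> else a (\<phi> e))"
  shows "facet_defining Ebar (bond_polytope Vbar Ebar) abar b"
proof -
  interpret vertex_split V E A v v1 v2
    using assms by unfold_locales
  \<comment> \<open>Connectedness of the whole graph is the case \<open>S = V\<close> of the
    equivalence between walks and bipartitions.\<close>
  have "induced_edges E V = E"
    using assms(1) unfolding simple_graph_def induced_edges_def by blast
  then have "unsplittable E V"
    using assms(2) connected_graph_iff_unsplittable[of V E] by simp
  from facet_defining_split[OF this assms(4), of \<omega> abar] assms(12,13) show ?thesis
    unfolding assms(9-11) by blast
qed

end
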